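(* Let $p$ be a prime, let $a\in\mathbb{C}_p$ with $a\neq 0$, let $f(x)=\frac{a}{x^2}$ for $x\in\mathbb{C}_p\setminus\{0\}$, and let $\alpha=(|a|_p)^{1/3}$. - If $p=2$, then for any $m=2,3,\dots$, the $m$-cycles of $f$ are attractors, and the open balls of radius $\alpha$ are contained in the basins of attraction; that is, for every point $x_*$ of every $m$-cycle, $x_*$ is an attractor for $\varphi=f^m$ and $U_\alpha(x_* )\subset\mathcal{A}(x_* )$. - If $p\geq 3$, then for any $m=2,3,\dots$, every $m$-cycle of $f$ is a center of a Siegel disk with radius $\alpha$; that is, for every point $x_*$ of every $m$-cycle, $U_\alpha(x_* )$ is a Siegel disk for $\varphi=f^m$.
   Context: $\mathbb{C}_p$ is the field of complex $p$-adic numbers (the completion of the algebraic closure of $\mathbb{Q}_p$) with the $p$-adic norm $|\cdot|_p$ normalized by $|p|_p=1/p$. For $c\in\mathbb{C}_p$ and $r>0$: $U_r(c)=\{x:|x-c|_p<r\}$, $S_r(c)=\{x:|x-c|_p=r\}$. $f^n$ is the $n$-fold composition of $f$; $f$ maps $\mathbb{C}_p\setminus\{0\}$ to itself. A point $x_*\in\mathbb{C}_p\setminus\{0\}$ is $m$-periodic if $f^m(x_* )=x_*$; it generates the $m$-cycle $x_*,f(x_* ),\dots,f^{m-1}(x_* )$. Every element of the cycle is a fixed point of $\varphi=f^m$, and the notions of attractor, basin and Siegel disk for a cycle refer to its elements as fixed points of $\varphi$. A fixed point $x_0$ of $\varphi$ is an attractor if there is a neighborhood of $x_0$ on which $\lim_{n\to\infty}\varphi^n(x)=x_0$;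 its basin of attraction is $\mathcal{A}(x_0)=\{x\in\mathbb{C}_p\setminus\{0\}:\varphi^n(x)\to x_0,\ n\to\infty\}$. A ball $U_r(x_0)$ contained in the domain $\mathbb{C}_p\setminus\{0\}$ is a Siegel disk for $\varphi$ if each sphere $S_\rho(x_0)$, $\rho<r$, is invariant, i.e. $x\in S_\rho(x_0)$ implies $\varphi^n(x)\in S_\rho(x_0)$ for all $n\geq 1$. *)

theory Defs
  imports "HOL-Analysis.Analysis" "HOL-Computational_Algebra.Polynomial"
begin

text \<open>
  The libraries contain no \<open>p\<close>-adic fields. The field of complex \<open>p\<close>-adic numbers is described
  here as what it is up to isometric isomorphism: a completion of an algebraic closure of the
  completion of the rationals with respect to the \<open>p\<close>-adic absolute value.

  The following class makes the library's metric notions (balls, spheres, open sets, limits,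
  completeness) those of a non-archimedean absolute value. The library's \<^const>\<open>norm\<close> cannot be
  used, since it is constrained to vector spaces over the reals.
\<close>

class nonarch_field = field_char_0 + metric_space +
  fixes absval :: "'a \<Rightarrow> real"
  assumes dist_absval: "dist x y = absval (x - y)"
    and absval_mult: "absval (x * y) = absval x * absval y"
    and absval_add_le: "absval (x + y) \<le> max (absval x) (absval y)"

text \<open>
  If in addition the absolute value of \<open>p\<close> is \<open>1 / p\<close>, then it restricts to the \<open>p\<close>-adic absolute
  value on the rationals, so in a complete field the closure of the rationals is their \<open>p\<close>-adic
  completion.
\<close>

definition padic_numbers :: "'a::nonarch_field set" where
  "padic_numbers = closure \<rat>"

definition algebraic_over :: "'a::field set \<Rightarrow> 'a \<Rightarrow> bool" where
  "algebraic_over F x \<longleftrightarrow> (\<exists>q. q \<noteq> 0 \<and> (\<forall>i. coeff q i \<in> F) \<and> poly q x = 0)"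

definition algebraically_closed_set :: "'a::field set \<Rightarrow> bool" where
  "algebraically_closed_set F \<longleftrightarrow>
     (\<forall>q. degree q > 0 \<and> (\<forall>i. coeff q i \<in> F) \<longrightarrow> (\<exists>x\<in>F. poly q x = 0))"

definition padic_algebraic_numbers :: "'a::nonarch_field set" where
  "padic_algebraic_numbers = {x. algebraic_over padic_numbers x}"

text \<open>
  Completeness is part of the class \<^class>\<open>complete_space\<close>. If the elements algebraic over the
  \<open>p\<close>-adic numbers form an algebraically closed set, they are an algebraic closure of the
  \<open>p\<close>-adic numbers; if they are also dense, then the whole type is its completion.
\<close>

definition complex_padic_field ::
    "nat \<Rightarrow> 'a::{nonarch_field, complete_space} itself \<Rightarrow> bool" where
  "complex_padic_field p _ \<longleftrightarrow>
     prime p \<and> absval (of_nat p :: 'a) = 1 / real p \<and>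
     algebraically_closed_set (padic_algebraic_numbers :: 'a set) \<and>
     closure (padic_algebraic_numbers :: 'a set) = UNIV"

text \<open>
  In the following definitions the map is a total function, and \<open>D\<close> is the domain on which it is
  considered.
\<close>

definition periodic_point :: "'a set \<Rightarrow> ('a \<Rightarrow> 'a) \<Rightarrow> nat \<Rightarrow> 'a \<Rightarrow> bool" where
  "periodic_point D f m x \<longleftrightarrow> x \<in> D \<and> (f ^^ m) x = x"

definition is_cycle :: "'a set \<Rightarrow> ('a \<Rightarrow> 'a) \<Rightarrow> nat \<Rightarrow> 'a set \<Rightarrow> bool" where
  "is_cycle D f m C \<longleftrightarrow> (\<exists>x. periodic_point D f m x \<and> C = (\<lambda>k. (f ^^ k) x) ` {..<m})"

definition attractor :: "'a::topological_space set \<Rightarrow> ('a \<Rightarrow> 'a) \<Rightarrow> 'a \<Rightarrow> bool" where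
  "attractor D \<phi> x\<^sub>0 \<longleftrightarrow>
     x\<^sub>0 \<in> D \<and> \<phi> x\<^sub>0 = x\<^sub>0 \<and>
     (\<exists>V. open V \<and> x\<^sub>0 \<in> V \<and> V \<subseteq> D \<and> (\<forall>x\<in>V. (\<lambda>n. (\<phi> ^^ n) x) \<longlonglongrightarrow> x\<^sub>0))"

definition basin :: "'a::topological_space set \<Rightarrow> ('a \<Rightarrow> 'a) \<Rightarrow> 'a \<Rightarrow> 'a set" where
  "basin D \<phi> x\<^sub>0 = {x \<in> D. (\<lambda>n. (\<phi> ^^ n) x) \<longlonglongrightarrow> x\<^sub>0}"

definition siegel_disk :: "'a::metric_space set \<Rightarrow> ('a \<Rightarrow> 'a) \<Rightarrow> 'a \<Rightarrow> real \<Rightarrow> bool" where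
  "siegel_disk D \<phi> x\<^sub>0 r \<longleftrightarrow>
     r > 0 \<and> \<phi> x\<^sub>0 = x\<^sub>0 \<and> ball x\<^sub>0 r \<subseteq> D \<and>
     (\<forall>\<rho>. 0 < \<rho> \<and> \<rho> < r \<longrightarrow>
        (\<forall>x \<in> sphere x\<^sub>0 \<rho>. \<forall>n\<ge>1. (\<phi> ^^ n) x \<in> sphere x\<^sub>0 \<rho>))"

end

theory Submission
  imports Defs
begin

text \<open>
  Let \<open>\<alpha>\<close> be the cube root of \<open>|a|\<close>. One step sends the ratio \<open>t = |x| / \<alpha>\<close> to \<open>1 / t\<^sup>2\<close>, so \<open>m\<close> steps multiply
  \<open>ln t\<close> by \<open>(-2)\<^sup>m \<noteq> 1\<close>. Hence every cycle lies on the sphere \<open>|x| = \<alpha>\<close>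
  (\<open>absval_of_periodic_point\<close>), and by the ultrametric inequality so does the whole
  open ball of radius \<open>\<alpha>\<close> around each point of the cycle. On this sphere
  \<open>|f c - f x| = |c - x| |c + x| / \<alpha>\<close> (\<open>dist_map\<close>), and the factor \<open>c + x = 2 c + (x - c)\<close> decides
  everything.

  For odd \<open>p\<close>, \<open>|2| = 1\<close>, so \<open>|2 c| = \<alpha>\<close> dominates \<open>|x - c| < \<alpha>\<close> and the factor has absolute
  value exactly \<open>\<alpha>\<close>: \<open>f\<close> preserves the distance to the orbit of \<open>c\<close>, which gives Siegel disks.
  For \<open>p = 2\<close>, \<open>|2 c| = \<alpha> / 2\<close>, so the factor is at most \<open>q \<alpha>\<close> with
  \<open>q = max (1/2) (|x - c| / \<alpha>) < 1\<close>: the distance to the orbit of \<open>c\<close> decays geometrically.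
\<close>

section \<open>Non-archimedean absolute values\<close>

lemma absval_eq_dist_0: "absval x = dist x (0 :: 'a::nonarch_field)"
  by (simp add: dist_absval)

lemma absval_nonneg: "absval (x :: 'a::nonarch_field) \<ge> 0"
  by (simp add: absval_eq_dist_0)

lemma absval_eq_0_iff: "absval (x :: 'a::nonarch_field) = 0 \<longleftrightarrow> x = 0"
  by (simp add: absval_eq_dist_0)

lemma absval_pos_iff: "absval (x :: 'a::nonarch_field) > 0 \<longleftrightarrow> x \<noteq> 0"
  by (simp add: absval_eq_dist_0)

lemma absval_1: "absval (1 :: 'a::nonarch_field) = 1"
  using absval_mult[of "1::'a" 1] absval_eq_0_iff[of "1::'a"] by simp

lemma absval_minus: "absval (- x :: 'a::nonarch_field) = absval x"
  using dist_commute[of 0 x] by (simp add: dist_absval)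

lemma absval_power: "absval (x ^ n :: 'a::nonarch_field) = absval x ^ n"
  by (induction n) (simp_all add: absval_1 absval_mult)

lemma absval_divide:
  fixes x y :: "'a::nonarch_field"
  assumes "y \<noteq> 0"
  shows "absval (x / y) = absval x / absval y"
  using absval_mult[of "x / y" y] assms by (simp add: absval_eq_0_iff field_simps)

lemma absval_of_nat_le_1: "absval (of_nat n :: 'a::nonarch_field) \<le> 1"
proof (induction n)
  case 0
  then show ?case by (simp add: absval_eq_dist_0)
next
  case (Suc n)
  then show ?case
    using absval_add_le[of "1 :: 'a" "of_nat n"] by (simp add: absval_1)
qed

text \<open>
  Two inequalities of the form \<open>|u + v| \<le> max |u| |v|\<close>, for \<open>x + y\<close> and for \<open>x = (x + y) - y\<close>,
  force equality because \<open>|y|\<close> cannot be the maximum in the second.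
\<close>
lemma absval_add_dominant:
  fixes x y :: "'a::nonarch_field"
  assumes "absval y < absval x"
  shows "absval (x + y) = absval x"
  using absval_add_le[of x y] absval_add_le[of "x + y" "- y"] assms
  by (simp add: absval_minus)

text \<open>
  If \<open>|2|\<close> were smaller than 1, then \<open>1 = n - 2 (n div 2)\<close> would be a sum of two terms of
  absolute value smaller than 1.
\<close>
lemma absval_2_eq_1:
  assumes "odd n" and n: "absval (of_nat n :: 'a::nonarch_field) < 1"
  shows "absval (2 :: 'a) = 1"
proof (rule ccontr)
  assume "absval (2 :: 'a) \<noteq> 1"
  then have two: "absval (2 :: 'a) < 1"
    using absval_of_nat_le_1[of 2, where 'a = 'a] by simp
  obtain k where k: "n = 2 * k + 1"
    using \<open>odd n\<close> by (rule oddE)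
  have "absval (2 * of_nat k :: 'a) \<le> absval (2 :: 'a) * 1"
    unfolding absval_mult by (intro mult_left_mono absval_of_nat_le_1 absval_nonneg)
  then have "absval (2 * of_nat k :: 'a) < 1"
    using two by simp
  moreover have "(1 :: 'a) = of_nat n + - (2 * of_nat k)"
    by (simp add: k)
  ultimately show False
    using absval_add_le[of "of_nat n :: 'a" "- (2 * of_nat k)"] n
    by (simp add: absval_minus absval_1)
qed

section \<open>The dynamics of the map on the sphere of radius \<open>\<alpha>\<close>\<close>

locale inverse_square_map =
  fixes a :: "'a::nonarch_field" and f :: "'a \<Rightarrow> 'a" and \<alpha> :: real
  assumes map_eq: "x \<noteq> 0 \<Longrightarrow> f x = a / x ^ 2"
    and radius_pos: "\<alpha> > 0"
    and radius_cubed: "\<alpha> ^ 3 = absval a"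
begin

lemma absval_map: "x \<noteq> 0 \<Longrightarrow> absval (f x) = \<alpha> ^ 3 / absval x ^ 2"
  by (simp add: map_eq absval_divide absval_power radius_cubed)

lemma map_nonzero: "x \<noteq> 0 \<Longrightarrow> f x \<noteq> 0"
  using absval_map[of x] absval_pos_iff[of x] absval_pos_iff[of "f x"] radius_pos by simp

lemma funpow_nonzero: "x \<noteq> 0 \<Longrightarrow> (f ^^ n) x \<noteq> 0"
  by (induction n) (simp_all add: map_nonzero)

lemma nonzero_of_absval_eq_radius: "absval x = \<alpha> \<Longrightarrow> x \<noteq> 0"
  using radius_pos by (simp flip: absval_pos_iff)

lemma absval_funpow_on_sphere: "absval x = \<alpha> \<Longrightarrow> absval ((f ^^ n) x) = \<alpha>"
proof (induction n)
  case (Suc n)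
  then show ?case
    using absval_map[OF nonzero_of_absval_eq_radius] radius_pos
    by (simp add: power3_eq_cube power2_eq_square)
qed simp

lemma ln_absval_funpow:
  assumes "x \<noteq> 0"
  shows "ln (absval ((f ^^ n) x) / \<alpha>) = (- 2) ^ n * ln (absval x / \<alpha>)"
proof (induction n)
  case (Suc n)
  define t where "t = absval ((f ^^ n) x) / \<alpha>"
  have nz: "(f ^^ n) x \<noteq> 0"
    using assms by (rule funpow_nonzero)
  then have t: "t > 0"
    using radius_pos by (simp add: t_def absval_pos_iff)
  have "absval ((f ^^ Suc n) x) / \<alpha> = inverse (t ^ 2)"
    using absval_map[OF nz] radius_pos
    by (simp add: t_def field_simps power3_eq_cube power2_eq_square)
  then have "ln (absval ((f ^^ Suc n) x) / \<alpha>) = - 2 * ln t"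
    using t by (simp add: ln_inverse ln_realpow)
  then show ?case
    using Suc.IH by (simp add: t_def)
qed simp

text \<open>
  Comparing logarithms, \<open>((-2)\<^sup>m - 1) ln (|x| / \<alpha>) = 0\<close>, and \<open>(-2)\<^sup>m \<noteq> 1\<close>.
\<close>
lemma absval_of_periodic_point:
  assumes "x \<noteq> 0" and "m > 0" and per: "(f ^^ m) x = x"
  shows "absval x = \<alpha>"
proof -
  have "\<bar>(- 2 :: real) ^ m\<bar> > 1"
    using \<open>m > 0\<close> by (simp add: power_abs)
  then have "(- 2 :: real) ^ m \<noteq> 1"
    by (metis abs_one less_irrefl)
  moreover have "ln (absval x / \<alpha>) = (- 2) ^ m * ln (absval x / \<alpha>)"
    using ln_absval_funpow[OF \<open>x \<noteq> 0\<close>, of m] per by simp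
  ultimately have "ln (absval x / \<alpha>) = 0"
    by simp
  then show ?thesis
    using \<open>x \<noteq> 0\<close> radius_pos by (simp add: absval_pos_iff)
qed

lemma absval_in_ball:
  assumes c: "absval c = \<alpha>" and x: "dist c x < \<alpha>"
  shows "absval x = \<alpha>"
  using absval_add_dominant[of "x - c" c] assms dist_absval[of x c]
  by (simp add: dist_commute[of c x])

lemma ball_subset_domain:
  assumes "absval c = \<alpha>"
  shows "ball c \<alpha> \<subseteq> - {0}"
  using absval_in_ball[OF assms] nonzero_of_absval_eq_radius by fastforce

text \<open>
  This is \<open>a / c\<^sup>2 - a / x\<^sup>2 = a (x - c) (x + c) / (c\<^sup>2 x\<^sup>2)\<close>, where \<open>|a| = \<alpha>\<^sup>3\<close> and \<open>|c| = |x| = \<alpha>\<close>.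
\<close>
lemma dist_map:
  assumes c: "absval c = \<alpha>" and x: "absval x = \<alpha>"
  shows "dist (f c) (f x) = dist c x * (absval (c + x) / \<alpha>)"
proof -
  have nz: "c \<noteq> 0" "x \<noteq> 0"
    using assms nonzero_of_absval_eq_radius by blast+
  then have "f c - f x = a * ((x - c) * (c + x)) / (c ^ 2 * x ^ 2)"
    by (simp add: map_eq field_simps power2_eq_square)
  then have "dist (f c) (f x) = \<alpha> ^ 3 * (dist x c * absval (c + x)) / (\<alpha> ^ 2 * \<alpha> ^ 2)"
    using nz c x
    by (simp add: dist_absval absval_divide absval_mult absval_power radius_cubed)
  then show ?thesis
    using radius_pos
    by (simp add: dist_commute[of x c] field_simps power3_eq_cube power2_eq_square)
qed

lemma dist_map_eq:
  assumes two: "absval (2 :: 'a) = 1" and c: "absval c = \<alpha>" and x: "dist c x < \<alpha>"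
  shows "dist (f c) (f x) = dist c x"
proof -
  have "absval (2 * c + (x - c)) = absval (2 * c)"
    using two c x
    by (intro absval_add_dominant) (simp add: absval_mult dist_commute[of c x] flip: dist_absval)
  then have "absval (c + x) = \<alpha>"
    using two c by (simp add: absval_mult algebra_simps)
  then show ?thesis
    using dist_map[OF c absval_in_ball[OF c x]] radius_pos by simp
qed

lemma dist_funpow_eq:
  assumes "absval (2 :: 'a) = 1" and c: "absval c = \<alpha>" and x: "dist c x < \<alpha>"
  shows "dist ((f ^^ n) c) ((f ^^ n) x) = dist c x"
proof (induction n)
  case (Suc n)
  then show ?case
    using dist_map_eq[OF assms(1) absval_funpow_on_sphere[OF c, of n]] x by simp
qed simp

text \<open>
  The condition \<open>dist c x \<le> q * \<alpha>\<close> is inherited by the images, so that one factor \<open>q < 1\<close>, fixed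
  by the starting point, serves for all later steps.
\<close>
lemma dist_map_le:
  assumes two: "absval (2 :: 'a) \<le> q" and c: "absval c = \<alpha>"
    and x: "dist c x \<le> q * \<alpha>" and q: "q < 1"
  shows "dist (f c) (f x) \<le> q * dist c x"
proof -
  have "q * \<alpha> < \<alpha>"
    using q radius_pos by simp
  then have sphere: "absval x = \<alpha>"
    using absval_in_ball[OF c] x by simp
  have "absval (2 * c + (x - c)) \<le> max (absval (2 * c)) (absval (x - c))"
    by (rule absval_add_le)
  also have "\<dots> \<le> q * \<alpha>"
    using two c x radius_pos
    by (simp add: absval_mult dist_commute[of c x] flip: dist_absval)
  finally have "absval (c + x) / \<alpha> \<le> q"
    using radius_pos by (simp add: algebra_simps divide_simps)
  then have "dist c x * (absval (c + x) / \<alpha>) \<le> dist c x * q"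
    by (intro mult_left_mono) simp_all
  then show ?thesis
    using dist_map[OF c sphere] by (simp add: mult.commute)
qed

lemma dist_funpow_le:
  assumes two: "absval (2 :: 'a) \<le> q" and c: "absval c = \<alpha>"
    and x: "dist c x \<le> q * \<alpha>" and q: "0 \<le> q" "q < 1"
  shows "dist ((f ^^ n) c) ((f ^^ n) x) \<le> q ^ n * dist c x"
proof (induction n)
  case (Suc n)
  have "q ^ n * dist c x \<le> 1 * dist c x"
    using q by (intro mult_right_mono power_le_one) simp_all
  then have "dist ((f ^^ n) c) ((f ^^ n) x) \<le> q * \<alpha>"
    using Suc.IH x by simp
  then have "dist (f ((f ^^ n) c)) (f ((f ^^ n) x)) \<le> q * dist ((f ^^ n) c) ((f ^^ n) x)"
    using dist_map_le[OF two absval_funpow_on_sphere[OF c]] q by blast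
  also have "\<dots> \<le> q * (q ^ n * dist c x)"
    using Suc.IH q by (intro mult_left_mono) simp_all
  finally show ?case by (simp add: mult.assoc)
qed simp

section \<open>Basins and Siegel disks of cycles\<close>

lemma cycle_point_periodic:
  assumes "is_cycle (- {0}) f m C" and "x \<in> C"
  shows "x \<noteq> 0" and "(f ^^ m) x = x"
proof -
  obtain y k where y: "y \<noteq> 0" "(f ^^ m) y = y" and x: "x = (f ^^ k) y"
    using assms by (auto simp: is_cycle_def periodic_point_def)
  show "x \<noteq> 0"
    using y x by (simp add: funpow_nonzero)
  have "(f ^^ m) ((f ^^ k) y) = (f ^^ k) ((f ^^ m) y)"
    by (metis add.commute comp_apply funpow_add)
  then show "(f ^^ m) x = x"
    using y x by simp
qed

lemma funpow_funpow_fixed: "(f ^^ m) c = c \<Longrightarrow> (f ^^ (m * n)) c = c"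
  by (induction n) (simp_all add: funpow_add)

lemma ball_converges_to_periodic_point:
  assumes two: "absval (2 :: 'a) < 1" and m: "m > 0"
    and c: "absval c = \<alpha>" and per: "(f ^^ m) c = c" and x: "dist c x < \<alpha>"
  shows "(\<lambda>n. ((f ^^ m) ^^ n) x) \<longlonglongrightarrow> c"
proof -
  define q where "q = max (absval (2 :: 'a)) (dist c x / \<alpha>)"
  have q: "absval (2 :: 'a) \<le> q" "dist c x \<le> q * \<alpha>" "0 \<le> q" "q < 1"
    using two x radius_pos absval_nonneg[of "2 :: 'a"]
    by (auto simp: q_def le_max_iff_disj simp flip: pos_divide_le_eq)
  have bound: "dist (((f ^^ m) ^^ n) x) c \<le> (q ^ m) ^ n * dist c x" for n
    using dist_funpow_le[OF q(1) c q(2-4), of "m * n"] funpow_funpow_fixed[OF per, of n]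
    by (simp add: funpow_mult power_mult dist_commute)
  have "q ^ m < 1"
    using q m by (simp add: power_less_one_iff)
  then have "(\<lambda>n. (q ^ m) ^ n * dist c x) \<longlonglongrightarrow> 0"
    using q by (intro tendsto_mult_left_zero LIMSEQ_power_zero) simp
  then have "(\<lambda>n. dist (((f ^^ m) ^^ n) x) c) \<longlonglongrightarrow> 0"
    by (rule tendsto_sandwich[OF _ _ tendsto_const, rotated 2])
      (auto intro!: always_eventually bound)
  then show ?thesis
    by (rule tendsto_dist_iff[THEN iffD2])
qed

lemma periodic_point_attractor:
  assumes "absval (2 :: 'a) < 1" and "m > 0" and "c \<noteq> 0" and per: "(f ^^ m) c = c"
  shows "attractor (- {0}) (f ^^ m) c" and "ball c \<alpha> \<subseteq> basin (- {0}) (f ^^ m) c"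
proof -
  have c: "absval c = \<alpha>"
    using assms(2-4) by (intro absval_of_periodic_point)
  have lim: "(\<lambda>n. ((f ^^ m) ^^ n) x) \<longlonglongrightarrow> c" if "x \<in> ball c \<alpha>" for x
    using that by (intro ball_converges_to_periodic_point assms(1,2) c per) simp
  show "ball c \<alpha> \<subseteq> basin (- {0}) (f ^^ m) c"
    using lim ball_subset_domain[OF c] by (auto simp: basin_def)
  show "attractor (- {0}) (f ^^ m) c"
    unfolding attractor_def
    using lim ball_subset_domain[OF c] radius_pos \<open>c \<noteq> 0\<close> per
    by (intro conjI exI[of _ "ball c \<alpha>"]) auto
qed

lemma periodic_point_siegel_disk:
  assumes two: "absval (2 :: 'a) = 1" and "m > 0" and "c \<noteq> 0" and per: "(f ^^ m) c = c"
  shows "siegel_disk (- {0}) (f ^^ m) c \<alpha>"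
proof -
  have c: "absval c = \<alpha>"
    using assms(2-4) by (intro absval_of_periodic_point)
  have "dist c (((f ^^ m) ^^ n) x) = dist c x" if "dist c x < \<alpha>" for x n
    using dist_funpow_eq[OF two c that, of "m * n"] funpow_funpow_fixed[OF per, of n]
    by (simp add: funpow_mult)
  then show ?thesis
    unfolding siegel_disk_def using ball_subset_domain[OF c] radius_pos per by auto
qed

end

theorem theorem4:
  fixes p :: nat
    and a :: "'a::{nonarch_field, complete_space}"
    and f :: "'a \<Rightarrow> 'a"
    and \<alpha> :: real
  assumes Cp: "complex_padic_field p TYPE('a)"
    and a: "a \<noteq> 0"
    and f: "\<And>x. x \<in> - {0} \<Longrightarrow> f x = a / x ^ 2"
    and \<alpha>: "\<alpha> = absval a powr (1 / 3)"
  shows "(p = 2 \<longrightarrow>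
            (\<forall>m\<ge>2. \<forall>C. is_cycle (- {0}) f m C \<longrightarrow>
               (\<forall>x\<in>C. attractor (- {0}) (f ^^ m) x \<and>
                       ball x \<alpha> \<subseteq> basin (- {0}) (f ^^ m) x))) \<and>
         (p \<ge> 3 \<longrightarrow>
            (\<forall>m\<ge>2. \<forall>C. is_cycle (- {0}) f m C \<longrightarrow>
               (\<forall>x\<in>C. siegel_disk (- {0}) (f ^^ m) x \<alpha>)))"
proof -
  have prime: "prime p" and abs_p: "absval (of_nat p :: 'a) = 1 / real p"
    using Cp by (auto simp: complex_padic_field_def)
  have pos: "\<alpha> > 0"
    using a absval_eq_0_iff[of a] by (simp add: \<alpha>)
  have "\<alpha> ^ 3 = \<alpha> powr 3"
    using pos by (simp add: powr_numeral)
  also have "\<dots> = absval a"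
    using absval_nonneg[of a] by (simp add: \<alpha> powr_powr)
  finally interpret inverse_square_map a f \<alpha>
    using f pos by unfold_locales simp_all
  have "attractor (- {0}) (f ^^ m) x \<and> ball x \<alpha> \<subseteq> basin (- {0}) (f ^^ m) x"
    if "p = 2" "m \<ge> 2" "is_cycle (- {0}) f m C" "x \<in> C" for m C x
    using periodic_point_attractor[of m x] cycle_point_periodic[OF that(3,4)] abs_p that(1,2)
    by simp
  moreover have "siegel_disk (- {0}) (f ^^ m) x \<alpha>"
    if "p \<ge> 3" "m \<ge> 2" "is_cycle (- {0}) f m C" "x \<in> C" for m C x
  proof -
    have "odd p"
      using prime \<open>p \<ge> 3\<close> by (intro prime_odd_nat) simp_all
    then have "absval (2 :: 'a) = 1"
      by (rule absval_2_eq_1) (use abs_p \<open>p \<ge> 3\<close> in simp)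
    then show ?thesis
      using periodic_point_siegel_disk[of m x] cycle_point_periodic[OF that(3,4)] that(2) by simp
  qed
  ultimately show ?thesis
    by blast
qed

end
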